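(* Consider the discrete-output hidden Markov model, the fixed projection matrix $U$, the moments $\mu,\Sigma,K$, and the estimators $\hat\mu,\hat\Sigma,\hat K$ built from $N$ i.i.d. triples $(Y_{i,1},Y_{i,2},Y_{i,3})$ described in the context, with $\Sigma$ invertible. Fix $T\ge 1$ and a fixed observation sequence $x_{1:T}=(x_1,\dots,x_T)$, and put $y_t=U^\top x_t$. Let $$\Pr(x_{1:T})=\mu^\top\Sigma^{-1}K(y_T)\Sigma^{-1}K(y_{T-1})\Sigma^{-1}\cdots K(y_1)\Sigma^{-1}\mu$$ be the likelihood of the sequence and $$\widehat{\Pr}(x_{1:T})=\hat\mu^\top\hat\Sigma^{-1}\hat K(y_T)\hat\Sigma^{-1}\hat K(y_{T-1})\hat\Sigma^{-1}\cdots\hat K(y_1)\hat\Sigma^{-1}\hat\mu$$ its spectral estimate. Define the vectors in $\mathbb{R}^d$ $$v=\left(\mu^\top\Sigma^{-1}K(y_T)\Sigma^{-1}\cdots K(y_1)\Sigma^{-1}\right)^\top,\qquad \tilde v=\Sigma^{-1}K(y_T)\Sigma^{-1}\cdots K(y_1)\Sigma^{-1}\mu,$$ $$a_t=\left(\mu^\top\Sigma^{-1}K(y_T)\Sigma^{-1}\cdots K(y_{t+1})\Sigma^{-1}\right)^\top,\qquad \tilde a_t=\Sigma^{-1}K(y_{t-1})\Sigma^{-1}\cdots K(y_1)\Sigma^{-1}\mu\qquad(1\le t\le T),$$ $$b_t=\left(\mu^\top\Sigma^{-1}K(y_T)\Sigma^{-1}\cdots K(y_{t+1})\Sigma^{-1}\right)^\top,\qquad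 \tilde b_t=\Sigma^{-1}K(y_t)\Sigma^{-1}\cdots K(y_1)\Sigma^{-1}\mu\qquad(0\le t\le T),$$ where empty products of $K$-factors are omitted (so $a_T=b_T=(\mu^\top\Sigma^{-1})^\top$ and $\tilde a_1=\tilde b_0=\Sigma^{-1}\mu$), and let $$\beta=\left[(v+\tilde v)^\top\,;\;-\Big(\sum_{t=0}^T\mathcal F(b_t\otimes\tilde b_t)\Big)^\top;\;\Big(\sum_{t=1}^T\mathcal F(a_t\otimes\tilde a_t\otimes y_t)\Big)^\top\right]^\top\in\mathbb{R}^{d+d^2+d^3}.$$ Then, as $N\to\infty$ with $T$ and $x_{1:T}$ fixed, $$\sqrt N\left(\widehat{\Pr}(x_{1:T})-\Pr(x_{1:T})\right)\xrightarrow{d}N\left(0,\;\beta^\top\,\mathrm{Cov}\left(\begin{bmatrix}Y_1\\ \mathcal F(Y_2\otimes Y_1)\\ \mathcal F(Y_3\otimes Y_1\otimes Y_2)\end{bmatrix}\right)\beta\right),$$ where $(Y_1,Y_2,Y_3)$ has the common distribution of the triples (and a normal distribution with variance $0$ is the point mass at $0$).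
   Context: Model. A hidden Markov model has hidden states $h_t\in\{1,\dots,d\}$ forming a time-homogeneous Markov chain with initial distribution $\pi\in\mathbb{R}^d$ (law of $h_1$) and transition matrix $\mathbf T\in\mathbb{R}^{d\times d}$, with $\mathbf T_{ij}=\Pr(h_{t+1}=i\mid h_t=j)$, and observations $X_t$ that are conditionally independent given the hidden states, the law of $X_t$ depending only on $h_t$ (and not on $t$). The output is discrete: there are $p$ possible symbols, encoded as the standard basis vectors of $\mathbb{R}^p$. Let $M=[M_1,\dots,M_d]\in\mathbb{R}^{p\times d}$ with $M_i=\mathrm E(X_t\mid h_t=i)$. Let $U\in\mathbb{R}^{p\times d}$ be a fixed (non-random) matrix whose columns are orthonormal and span the column space of $M$ (e.g. the first $d$ left singular vectors of $\mathrm E[X_2X_1^\top]$). Put $Y_t=U^\top X_t\in\mathbb{R}^d$. Moments. $\mu=\mathrm E(Y_1)=U^\top M\pi$; $\Sigma=\mathrm E(Y_2Y_1^\top)=U^\top M\mathbf T\,\mathrm{diag}(\pi)M^\top U$, assumed invertible; $K$ is the $d\times d\times d$ tensor $K=\mathrm E(Y_3\otimes Y_1\otimes Y_2)$, and for $a\in\mathbb{R}^d$, $K(a)$ is the $d\times d$ matrix $K(a)_{ij}=\sum_k K^{(i,j,k)}a_k$, i.e. $K(a)=\mathrm E(Y_3Y_1^\top\,(Y_2^\top a))=U^\top M\mathbf T\,\mathrm{diag}(M^\top Ua)\,\mathbf T\,\mathrm{diag}(\pi)M^\top U$. With these definitions the displayed product for $\Pr(x_{1:T})$ is the probability that $(X_1,\dots,X_T)=(x_1,\dots,x_T)$.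 Estimators. $(Y_{i,1},Y_{i,2},Y_{i,3})$, $i=1,\dots,N$, are i.i.d. copies of $(Y_1,Y_2,Y_3)$, and $\hat\mu=\frac1N\sum_{i=1}^N Y_{i,1}$, $\hat\Sigma=\frac1N\sum_{i=1}^N Y_{i,2}Y_{i,1}^\top$, $\hat K=\frac1N\sum_{i=1}^N Y_{i,3}\otimes Y_{i,1}\otimes Y_{i,2}$, with $\hat K(a)_{ij}=\sum_k\hat K^{(i,j,k)}a_k$. On the event that $\hat\Sigma$ is singular, $\widehat{\Pr}(x_{1:T})$ may be given any fixed value, e.g. $0$. Notation. $\otimes$ is the outer product: $(u\otimes w)^{(i,j)}=u_iw_j$ and $(u\otimes w\otimes z)^{(i,j,k)}=u_iw_jz_k$. The flattening operator $\mathcal F$ lists the entries of a $d\times d$ matrix or a $d\times d\times d$ tensor as a column vector in lexicographic order of indices: $\mathcal F(A)=[A^{(1,1)},A^{(1,2)},\dots,A^{(d,d)}]^\top$, $\mathcal F(B)=[B^{(1,1,1)},B^{(1,1,2)},\dots,B^{(d,d,d)}]^\top$. $\mathrm{Cov}$ of a random vector is its covariance matrix. *)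

theory Defs
  imports "HOL-Probability.Probability"
begin

text \<open>
  Time starts at 1; the values of the two processes at time 0 play no role. The hidden states are
  the elements of a finite type, the symbols are the elements of another finite type and are
  encoded as the standard basis vectors \<^term>\<open>axis k 1\<close>. Conditioning is only on events of
  positive probability, so the parameters attached to a state that is never visited are constrained
  only to be stochastic.
\<close>

definition hidden_path :: "'w measure \<Rightarrow> (nat \<Rightarrow> 'w \<Rightarrow> 'd) \<Rightarrow> nat \<Rightarrow> (nat \<Rightarrow> 'd) \<Rightarrow> 'w set" where
  "hidden_path \<Omega> h n s = {\<omega> \<in> space \<Omega>. \<forall>t\<in>{1..n}. h t \<omega> = s t}"

locale hidden_markov_model = prob_space \<Omega> for \<Omega> :: "'w measure" +
  fixes h :: "nat \<Rightarrow> 'w \<Rightarrow> 'd::finite"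
    and X :: "nat \<Rightarrow> 'w \<Rightarrow> real ^ 'p::finite"
    and \<pi> :: "real ^ 'd"
    and Tr :: "real ^ 'd ^ 'd"
    and emission :: "'d \<Rightarrow> 'p pmf"
  assumes hidden_measurable: "\<And>t. t \<ge> 1 \<Longrightarrow> h t \<in> measurable \<Omega> (count_space UNIV)"
    and output_measurable: "\<And>t. t \<ge> 1 \<Longrightarrow> X t \<in> borel_measurable \<Omega>"
    and output_discrete: "\<And>t \<omega>. t \<ge> 1 \<Longrightarrow> \<omega> \<in> space \<Omega> \<Longrightarrow> X t \<omega> \<in> range (\<lambda>k. axis k 1)"
    and initial: "\<And>i. \<pi> $ i = \<P>(\<omega> in \<Omega>. h 1 \<omega> = i)"
    and transition_nonneg: "\<And>i j. Tr $ i $ j \<ge> 0"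
    and transition_sum: "\<And>j. (\<Sum>i\<in>UNIV. Tr $ i $ j) = 1"
    and markov: "\<And>n s i. n \<ge> 1 \<Longrightarrow> measure \<Omega> (hidden_path \<Omega> h n s) > 0 \<Longrightarrow>
        \<P>(\<omega> in \<Omega>. h (Suc n) \<omega> = i \<bar> \<omega> \<in> hidden_path \<Omega> h n s) = Tr $ i $ s n"
    and output_cond_indep: "\<And>n s. measure \<Omega> (hidden_path \<Omega> h n s) > 0 \<Longrightarrow>
        prob_space.indep_vars (uniform_measure \<Omega> (hidden_path \<Omega> h n s)) (\<lambda>_. borel) X {1..n}"
    and output_law: "\<And>n s t k. t \<in> {1..n} \<Longrightarrow> measure \<Omega> (hidden_path \<Omega> h n s) > 0 \<Longrightarrow>
        \<P>(\<omega> in \<Omega>. X t \<omega> = axis k 1 \<bar> \<omega> \<in> hidden_path \<Omega> h n s) = pmf (emission (s t)) k"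

text \<open>
  Column \<open>i\<close> is the conditional mean of the output given hidden state \<open>i\<close>, that is, the mean
  of the encoded symbol under the emission law of \<open>i\<close>.
\<close>

definition output_mean :: "('d \<Rightarrow> 'p pmf) \<Rightarrow> real ^ 'd ^ 'p::finite" where
  "output_mean emission =
    (\<chi> k i. measure_pmf.expectation (emission i) (\<lambda>l. axis l 1 :: real ^ 'p) $ k)"

definition orthonormal_columns_spanning :: "real ^ 'd ^ 'p \<Rightarrow> real ^ 'd ^ 'p \<Rightarrow> bool" where
  "orthonormal_columns_spanning U A \<longleftrightarrow>
    (\<forall>i j. column i U \<bullet> column j U = (if i = j then 1 else 0)) \<and>
    span (columns U) = span (columns A)"

definition outer2 :: "real ^ 'd \<Rightarrow> real ^ 'd \<Rightarrow> real ^ 'd ^ 'd" where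
  "outer2 u w = (\<chi> i j. u $ i * w $ j)"

definition outer3 :: "real ^ 'd \<Rightarrow> real ^ 'd \<Rightarrow> real ^ 'd \<Rightarrow> real ^ 'd ^ 'd ^ 'd" where
  "outer3 u w z = (\<chi> i j k. u $ i * w $ j * z $ k)"

definition tensor_apply :: "real ^ 'd ^ 'd ^ 'd \<Rightarrow> real ^ 'd::finite \<Rightarrow> real ^ 'd ^ 'd" where
  "tensor_apply K a = (\<chi> i j. \<Sum>k\<in>UNIV. K $ i $ j $ k * a $ k)"

text \<open>
  Flattened arrays are indexed by the tuples of indices themselves, and a stacked vector by the sum
  of the index types of its blocks. This fixes no enumeration of the entries; the flattened vectors
  below enter only through a quadratic form of a covariance matrix, which does not depend on one.
\<close>

definition flatten2 :: "real ^ 'd ^ 'd \<Rightarrow> real ^ ('d \<times> 'd)" where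
  "flatten2 A = (\<chi> p. case p of (i, j) \<Rightarrow> A $ i $ j)"

definition flatten3 :: "real ^ 'd ^ 'd ^ 'd \<Rightarrow> real ^ ('d \<times> 'd \<times> 'd)" where
  "flatten3 B = (\<chi> p. case p of (i, j, k) \<Rightarrow> B $ i $ j $ k)"

definition stack3 :: "real ^ 'a \<Rightarrow> real ^ 'b \<Rightarrow> real ^ 'c \<Rightarrow> real ^ ('a + 'b + 'c)" where
  "stack3 u w z = (\<chi> i. case i of Inl a \<Rightarrow> u $ a | Inr (Inl b) \<Rightarrow> w $ b | Inr (Inr c) \<Rightarrow> z $ c)"

definition covariance_matrix :: "'w measure \<Rightarrow> ('w \<Rightarrow> real ^ 'n) \<Rightarrow> real ^ 'n ^ 'n" where
  "covariance_matrix \<Omega> Z = (\<chi> i j.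
    LINT \<omega>|\<Omega>. (Z \<omega> $ i - (LINT \<omega>'|\<Omega>. Z \<omega>' $ i)) * (Z \<omega> $ j - (LINT \<omega>'|\<Omega>. Z \<omega>' $ j)))"

text \<open>The second parameter is the variance, whereas \<^const>\<open>normal_density\<close> takes the standard deviation.\<close>

definition normal_law :: "real \<Rightarrow> real \<Rightarrow> real measure" where
  "normal_law m v =
    (if v = 0 then return borel m else density lborel (\<lambda>x. ennreal (normal_density m (sqrt v) x)))"

text \<open>
  \<open>spectral_chain S K y s t\<close> is
  \<open>S\<inverse> K(y\<^sub>t) S\<inverse> K(y\<^sub>t\<^sub>-\<^sub>1) \<dots> S\<inverse> K(y\<^sub>s) S\<inverse>\<close>, which is just \<open>S\<inverse>\<close> if \<open>s > t\<close>.
\<close>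

definition spectral_chain ::
    "real ^ 'd ^ 'd \<Rightarrow> real ^ 'd ^ 'd ^ 'd \<Rightarrow> (nat \<Rightarrow> real ^ 'd::finite) \<Rightarrow> nat \<Rightarrow> nat \<Rightarrow> real ^ 'd ^ 'd" where
  "spectral_chain S K y s t =
    foldl (\<lambda>A r. matrix_inv S ** tensor_apply K (y r) ** A) (matrix_inv S) [s..<Suc t]"

definition spectral_likelihood ::
    "real ^ 'd \<Rightarrow> real ^ 'd ^ 'd \<Rightarrow> real ^ 'd ^ 'd ^ 'd \<Rightarrow> (nat \<Rightarrow> real ^ 'd::finite) \<Rightarrow> nat \<Rightarrow> real" where
  "spectral_likelihood m S K y T = m \<bullet> (spectral_chain S K y 1 T *v m)"

definition spectral_beta ::
    "real ^ 'd \<Rightarrow> real ^ 'd ^ 'd \<Rightarrow> real ^ 'd ^ 'd ^ 'd \<Rightarrow> (nat \<Rightarrow> real ^ 'd::finite) \<Rightarrow> nat \<Rightarrow>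
      real ^ ('d + ('d \<times> 'd) + ('d \<times> 'd \<times> 'd))" where
  "spectral_beta m S K y T =
    (let v = m v* spectral_chain S K y 1 T;
         v' = spectral_chain S K y 1 T *v m;
         a = (\<lambda>t. m v* spectral_chain S K y (t + 1) T);
         a' = (\<lambda>t. spectral_chain S K y 1 (t - 1) *v m);
         b = (\<lambda>t. m v* spectral_chain S K y (t + 1) T);
         b' = (\<lambda>t. spectral_chain S K y 1 t *v m)
     in stack3 (v + v')
          (- (\<Sum>t\<in>{0..T}. flatten2 (outer2 (b t) (b' t))))
          (\<Sum>t\<in>{1..T}. flatten3 (outer3 (a t) (a' t) (y t))))"

end

(*
  The spectral likelihood is a smooth function of the moments (\<mu>, \<Sigma>, K) on the open set where \<Sigma> is
  invertible, and its estimate is that function evaluated at a sample mean of bounded i.i.d. vectors,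
  so the delta method applies. By the product rule and d(\<Sigma>^-1) = - \<Sigma>^-1 d\<Sigma> \<Sigma>^-1, each of the
  factors \<Sigma>^-1, K(y_t), \<mu> contributes one bilinear form in its own increment, whose coefficients
  are the outer products collected in \<beta>; hence the derivative is the inner product with \<beta> and the
  limiting variance is the quadratic form of the covariance matrix at \<beta>. The observations have
  finitely many values, which gives all the integrability that is needed.
  Weak convergence survives the remainder of the linearisation and a rescaling by Levy's continuity
  theorem.
*)

theory Submission
  imports Defs
begin

section \<open>The delta method for sample means\<close>

lemma (in prob_space) indep_sets_reindex:
  assumes "indep_sets F (f ` I)" and inj: "inj_on f I"
  shows "indep_sets (\<lambda>i. F (f i)) I"
proof (rule indep_setsI)
  show "F (f i) \<subseteq> events" if "i \<in> I" for i
    using assms(1) that by (auto simp: indep_sets_def)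
next
  fix A J assume J: "J \<noteq> {}" "J \<subseteq> I" "finite J" and A: "\<forall>j\<in>J. A j \<in> F (f j)"
  define B where "B = (\<lambda>k. A (the_inv_into J f k))"
  have injJ: "inj_on f J" using inj J(2) by (rule inj_on_subset)
  have B: "B (f j) = A j" if "j \<in> J" for j
    using that injJ by (simp add: B_def the_inv_into_f_f)
  have "prob (\<Inter>k\<in>f ` J. B k) = (\<Prod>k\<in>f ` J. prob (B k))"
    by (rule indep_setsD[OF assms(1)]) (use J A B in auto)
  then show "prob (\<Inter>j\<in>J. A j) = (\<Prod>j\<in>J. prob (A j))"
    by (simp add: prod.reindex[OF injJ] B)
qed

lemma (in prob_space) indep_vars_reindex:
  assumes "indep_vars N X (f ` I)" and "inj_on f I"
  shows "indep_vars (\<lambda>i. N (f i)) (\<lambda>i. X (f i)) I"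
  using assms indep_sets_reindex[OF _ assms(2)] unfolding indep_vars_def by blast

text \<open>The two variables may live on different probability spaces. This carries moments from
  one member of an i.i.d. sequence to another, and from the sample space to the space of the Markov
  model.\<close>

lemma
  fixes f :: "'b \<Rightarrow> 'c::{banach, second_countable_topology}"
  assumes "distr M N X = distr M' N X'"
    and "X \<in> measurable M N" "X' \<in> measurable M' N" "f \<in> borel_measurable N"
  shows integrable_eq_if_distr_eq: "integrable M (\<lambda>\<omega>. f (X \<omega>)) \<longleftrightarrow> integrable M' (\<lambda>\<omega>. f (X' \<omega>))"
    and integral_eq_if_distr_eq: "(LINT \<omega>|M. f (X \<omega>)) = (LINT \<omega>|M'. f (X' \<omega>))"
  by (metis assms integrable_distr_eq) (metis assms integral_distr)

section \<open>Stability of weak convergence under null perturbations and scaling\<close>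

text \<open>Since exp(itA) has modulus 1, the integrands differ by |exp(itB) - 1|, which is at most
  both |tB| and 2. The first bound serves where |B| is at most \<eta>, the second on the exceptional
  event.\<close>

lemma (in prob_space) norm_char_add_diff_le:
  assumes [measurable]: "A \<in> borel_measurable M" "B \<in> borel_measurable M" and "\<eta> \<ge> 0"
  shows "cmod (char (distr M borel (\<lambda>\<omega>. A \<omega> + B \<omega>)) t - char (distr M borel A) t)
    \<le> \<bar>t\<bar> * \<eta> + 2 * prob {\<omega>\<in>space M. \<eta> < \<bar>B \<omega>\<bar>}"
proof -
  let ?E = "{\<omega>\<in>space M. \<eta> < \<bar>B \<omega>\<bar>}"
  have i1: "integrable M (\<lambda>\<omega>. iexp (t * (A \<omega> + B \<omega>)))" and i2: "integrable M (\<lambda>\<omega>. iexp (t * A \<omega>))"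
    by (intro integrable_iexp; simp)+
  have "char (distr M borel (\<lambda>\<omega>. A \<omega> + B \<omega>)) t - char (distr M borel A) t
      = (CLINT \<omega>|M. iexp (t * (A \<omega> + B \<omega>)) - iexp (t * A \<omega>))"
    using i1 i2 by (simp add: char_def integral_distr)
  also have "cmod \<dots> \<le> (LINT \<omega>|M. cmod (iexp (t * (A \<omega> + B \<omega>)) - iexp (t * A \<omega>)))"
    by (rule integral_norm_bound)
  also have "\<dots> \<le> (LINT \<omega>|M. \<bar>t\<bar> * \<eta> + 2 * indicator ?E \<omega>)"
  proof (rule integral_mono)
    fix \<omega> assume w: "\<omega> \<in> space M"
    have "iexp (t * (A \<omega> + B \<omega>)) - iexp (t * A \<omega>) = iexp (t * A \<omega>) * (iexp (t * B \<omega>) - 1)"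
      by (simp add: algebra_simps exp_add)
    then have eq: "cmod (iexp (t * (A \<omega> + B \<omega>)) - iexp (t * A \<omega>)) = cmod (iexp (t * B \<omega>) - 1)"
      by (simp add: norm_mult del: of_real_mult)
    have b1: "cmod (iexp (t * B \<omega>) - 1) \<le> \<bar>t * B \<omega>\<bar>"
      using iexp_approx1[of "t * B \<omega>" 0] by (simp del: of_real_mult)
    have b2: "cmod (iexp (t * B \<omega>) - 1) \<le> 2"
      using iexp_approx2[of "t * B \<omega>" 0] by (simp del: of_real_mult)
    have "cmod (iexp (t * B \<omega>) - 1) \<le> \<bar>t\<bar> * \<eta> + 2 * indicator ?E \<omega>"
    proof (cases "\<eta> < \<bar>B \<omega>\<bar>")
      case True
      then have "indicator ?E \<omega> = (1::real)" using w by simp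
      then show ?thesis using b2 \<open>\<eta> \<ge> 0\<close> by (simp add: add_increasing del: of_real_mult)
    next
      case False
      then have "\<bar>t * B \<omega>\<bar> \<le> \<bar>t\<bar> * \<eta>" by (simp add: abs_mult mult_left_mono)
      then show ?thesis using b1 False by simp
    qed
    then show "cmod (iexp (t * (A \<omega> + B \<omega>)) - iexp (t * A \<omega>)) \<le> \<bar>t\<bar> * \<eta> + 2 * indicator ?E \<omega>"
      using eq by simp
  qed (use i1 i2 in \<open>auto intro!: Bochner_Integration.integrable_add integrable_real_indicator
        integrable_mult_right simp: emeasure_eq_measure\<close>)
  also have "\<dots> = \<bar>t\<bar> * \<eta> + 2 * prob ?E"
    by (subst Bochner_Integration.integral_add)
      (auto intro!: integrable_real_indicator integrable_mult_right simp: emeasure_eq_measure prob_space)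
  finally show ?thesis .
qed

text \<open>This is the additive form of Slutsky's theorem: adding a term that tends to 0 in
  probability does not change the limit of the characteristic functions, and Levy's theorem turns
  this back into weak convergence.\<close>

lemma (in prob_space) weak_conv_m_add_null:
  assumes [measurable]: "\<And>n. A n \<in> borel_measurable M" "\<And>n. B n \<in> borel_measurable M"
    and L: "real_distribution L"
    and conv: "weak_conv_m (\<lambda>n. distr M borel (A n)) L"
    and null: "\<And>\<eta>::real. \<eta> > 0 \<Longrightarrow> (\<lambda>n. prob {\<omega>\<in>space M. \<eta> < \<bar>B n \<omega>\<bar>}) \<longlonglongrightarrow> 0"
  shows "weak_conv_m (\<lambda>n. distr M borel (\<lambda>\<omega>. A n \<omega> + B n \<omega>)) L"
proof (rule levy_continuity[OF _ L])
  show "real_distribution (distr M borel (\<lambda>\<omega>. A n \<omega> + B n \<omega>))" for n by simp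
next
  fix t
  have "(\<lambda>n. char (distr M borel (A n)) t) \<longlonglongrightarrow> char L t"
    by (rule levy_continuity1[OF _ L conv]) simp
  moreover have "(\<lambda>n. char (distr M borel (\<lambda>\<omega>. A n \<omega> + B n \<omega>)) t - char (distr M borel (A n)) t) \<longlonglongrightarrow> 0"
  proof (rule tendstoI)
    fix e :: real assume e: "e > 0"
    \<comment> \<open>The bound of \<open>norm_char_add_diff_le\<close> is split into halves: this
      \<eta> keeps |t| \<eta> at most e/2, and a probability below e/4 keeps the other term below
      e/2. The \<open>+ 1\<close> covers t = 0.\<close>
    define \<eta> where "\<eta> = e / (2 * (\<bar>t\<bar> + 1))"
    have \<eta>: "\<eta> > 0" using e by (auto simp: \<eta>_def intro!: divide_pos_pos)
    have t: "\<bar>t\<bar> * \<eta> \<le> e / 2"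
    proof -
      have "\<bar>t\<bar> * \<eta> = (\<bar>t\<bar> / (\<bar>t\<bar> + 1)) * (e / 2)" by (simp add: \<eta>_def field_simps)
      also have "\<dots> \<le> 1 * (e / 2)" using e by (intro mult_right_mono) auto
      finally show ?thesis by simp
    qed
    have "\<forall>\<^sub>F n in sequentially. prob {\<omega>\<in>space M. \<eta> < \<bar>B n \<omega>\<bar>} < e / 4"
      using null[OF \<eta>] e by (intro order_tendstoD) auto
    then show "\<forall>\<^sub>F n in sequentially. dist (char (distr M borel (\<lambda>\<omega>. A n \<omega> + B n \<omega>)) t
        - char (distr M borel (A n)) t) 0 < e"
    proof eventually_elim
      case (elim n)
      then show ?case
        using norm_char_add_diff_le[of "A n" "B n" \<eta> t] \<eta> t by simp
    qed
  qed
  ultimately have "(\<lambda>n. char (distr M borel (A n)) t + (char (distr M borel (\<lambda>\<omega>. A n \<omega> + B n \<omega>)) t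
      - char (distr M borel (A n)) t)) \<longlonglongrightarrow> char L t + 0"
    by (rule tendsto_add)
  then show "(\<lambda>n. char (distr M borel (\<lambda>\<omega>. A n \<omega> + B n \<omega>)) t) \<longlonglongrightarrow> char L t"
    by simp
qed

text \<open>Scaling a variable by \<open>c\<close> only moves the argument of its characteristic
  function from t to tc.\<close>

lemma (in prob_space) weak_conv_m_scale:
  assumes [measurable]: "\<And>n. A n \<in> borel_measurable M"
    and L: "real_distribution L"
    and conv: "weak_conv_m (\<lambda>n. distr M borel (A n)) L"
  shows "weak_conv_m (\<lambda>n. distr M borel (\<lambda>\<omega>. c * A n \<omega>)) (distr L borel (\<lambda>x. c * x))"
proof (rule levy_continuity)
  interpret L: real_distribution L by fact
  show "real_distribution (distr M borel (\<lambda>\<omega>. c * A n \<omega>))" for n by simp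
  show "real_distribution (distr L borel (\<lambda>x. c * x))" by simp
  fix t
  have "(\<lambda>n. char (distr M borel (A n)) (t * c)) \<longlonglongrightarrow> char L (t * c)"
    by (rule levy_continuity1[OF _ L conv]) simp
  then show "(\<lambda>n. char (distr M borel (\<lambda>\<omega>. c * A n \<omega>)) t) \<longlonglongrightarrow> char (distr L borel (\<lambda>x. c * x)) t"
    by (simp add: char_def integral_distr mult.assoc)
qed

section \<open>The central limit theorem with a possibly vanishing variance\<close>

lemma distr_std_normal_scale:
  assumes "s > 0"
  shows "distr std_normal_distribution borel (\<lambda>x. s * x) = density lborel (normal_density 0 s)"
proof -
  interpret N: real_distribution std_normal_distribution by (rule real_dist_normal_dist)
  \<comment> \<open>The identity is viewed as a standard normal variable on its own law, so that the
    affine rule for normal variables applies.\<close>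
  have "distributed std_normal_distribution lborel (\<lambda>x. x) std_normal_density"
    by (auto simp: distributed_def distr_id2 sets_density)
  from N.normal_density_affine[OF this, of s 0] assms
  have "distributed std_normal_distribution lborel (\<lambda>x. s * x) (normal_density 0 s)"
    by simp
  then have "distr std_normal_distribution lborel (\<lambda>x. s * x) = density lborel (normal_density 0 s)"
    by (simp add: distributed_def)
  moreover have "distr std_normal_distribution lborel (\<lambda>x. s * x) = distr std_normal_distribution borel (\<lambda>x. s * x)"
    by (rule distr_cong) auto
  ultimately show ?thesis by simp
qed

lemma real_distribution_normal_law:
  assumes "v \<ge> 0"
  shows "real_distribution (normal_law m v)"
proof (cases "v = 0")
  case True
  then show ?thesis
    by (auto simp: normal_law_def real_distribution_def real_distribution_axioms_def
        intro!: prob_space_return)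
next
  case False
  with assms have "prob_space (density lborel (normal_density m (sqrt v)))"
    by (intro prob_space_normal_density) auto
  with False show ?thesis
    by (auto simp: normal_law_def real_distribution_def real_distribution_axioms_def)
qed

text \<open>For positive variance, the standardised theorem is rescaled by the standard deviation.
  For variance 0, every summand vanishes almost surely, so each normalised sum already has the
  limiting law, the point mass at 0.\<close>

lemma (in prob_space) central_limit_theorem_normal_law:
  fixes X :: "nat \<Rightarrow> 'a \<Rightarrow> real"
  assumes indep: "indep_vars (\<lambda>_. borel) X UNIV"
    and distrib: "\<And>n. distr M borel (X n) = \<nu>"
    and mean: "expectation (X 0) = 0"
    and square_integrable: "integrable M (\<lambda>\<omega>. (X 0 \<omega>)\<^sup>2)"
  shows "weak_conv_m (\<lambda>n. distr M borel (\<lambda>\<omega>. (\<Sum>i<n. X i \<omega>) / sqrt (real n)))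
    (normal_law 0 (expectation (\<lambda>\<omega>. (X 0 \<omega>)\<^sup>2)))"
proof -
  have meas[measurable]: "X n \<in> borel_measurable M" for n
    using indep by (auto simp: indep_vars_def)
  have same: "distr M borel (X n) = distr M borel (X 0)" for n by (simp add: distrib)
  have sq: "integrable M (\<lambda>\<omega>. (X n \<omega>)\<^sup>2)" for n
    using square_integrable integrable_eq_if_distr_eq[OF same meas meas, of "\<lambda>x. x\<^sup>2" n] by simp
  define v where "v = expectation (\<lambda>\<omega>. (X 0 \<omega>)\<^sup>2)"
  have vn: "expectation (\<lambda>\<omega>. (X n \<omega>)\<^sup>2) = v" for n
    unfolding v_def by (rule integral_eq_if_distr_eq[OF same meas meas]) simp
  have mn: "expectation (X n) = 0" for n
    using mean integral_eq_if_distr_eq[OF same meas meas, of "\<lambda>x. x" n] by simp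
  have "v \<ge> 0" unfolding v_def by (rule integral_nonneg_AE) simp
  then consider "v = 0" | "v > 0" by linarith
  then show ?thesis
  proof cases
    case 1
    have "AE \<omega> in M. X n \<omega> = 0" for n
      using integral_nonneg_eq_0_iff_AE[OF sq, of n] vn[of n] 1 by simp
    then have ae: "AE \<omega> in M. \<forall>n. X n \<omega> = 0" by (simp add: AE_all_countable)
    have "distr M borel (\<lambda>\<omega>. (\<Sum>i<n. X i \<omega>) / sqrt (real n)) = return borel 0" for n
    proof -
      have "distr M borel (\<lambda>\<omega>. (\<Sum>i<n. X i \<omega>) / sqrt (real n)) = distr M borel (\<lambda>_. 0)"
        using ae by (intro distr_cong_AE) auto
      then show ?thesis by (simp add: distr_const)
    qed
    then show ?thesis
      unfolding v_def[symmetric] using 1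
      by (simp add: normal_law_def weak_conv_m_def weak_conv_def)
  next
    case 2
    define s where "s = sqrt v"
    have s: "s > 0" "s\<^sup>2 = v" using 2 by (auto simp: s_def)
    have "weak_conv_m (\<lambda>n. distr M borel (\<lambda>\<omega>. (\<Sum>i<n. X i \<omega>) / sqrt (real n * s\<^sup>2))) std_normal_distribution"
      by (rule central_limit_theorem_zero_mean[OF indep mn s(1) sq _ distrib]) (simp add: mn vn s)
    from weak_conv_m_scale[OF _ real_dist_normal_dist this, of s]
    have "weak_conv_m (\<lambda>n. distr M borel (\<lambda>\<omega>. s * ((\<Sum>i<n. X i \<omega>) / sqrt (real n * s\<^sup>2))))
      (density lborel (normal_density 0 s))"
      by (simp add: distr_std_normal_scale s)
    moreover have "s * (x / sqrt (real n * s\<^sup>2)) = x / sqrt (real n)" for x n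
      using s(1) by (simp add: real_sqrt_mult)
    ultimately show ?thesis
      unfolding v_def[symmetric] using 2 by (simp add: normal_law_def s_def)
  qed
qed

section \<open>Chebyshev's inequality for vector-valued sums\<close>

text \<open>By induction on \<open>n\<close>: the new summand is independent of the sum of the
  earlier ones and centred, so the cross term of the square is integrable with expectation
  0.\<close>

lemma (in prob_space) second_moment_sum:
  fixes X :: "nat \<Rightarrow> 'a \<Rightarrow> real"
  assumes indep: "indep_vars (\<lambda>_. borel) X UNIV"
    and mean: "\<And>n. expectation (X n) = 0"
    and sq: "\<And>n. integrable M (\<lambda>\<omega>. (X n \<omega>)\<^sup>2)"
  shows "integrable M (\<lambda>\<omega>. (\<Sum>i<n. X i \<omega>)\<^sup>2)"
    and "expectation (\<lambda>\<omega>. (\<Sum>i<n. X i \<omega>)\<^sup>2) = (\<Sum>i<n. expectation (\<lambda>\<omega>. (X i \<omega>)\<^sup>2))"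
proof -
  have meas[measurable]: "X n \<in> borel_measurable M" for n
    using indep by (auto simp: indep_vars_def)
  have int: "integrable M (X n)" for n
    by (rule square_integrable_imp_integrable[OF meas sq])
  have "integrable M (\<lambda>\<omega>. (\<Sum>i<n. X i \<omega>)\<^sup>2) \<and>
    expectation (\<lambda>\<omega>. (\<Sum>i<n. X i \<omega>)\<^sup>2) = (\<Sum>i<n. expectation (\<lambda>\<omega>. (X i \<omega>)\<^sup>2))"
  proof (induction n)
    case (Suc n)
    let ?S = "\<lambda>\<omega>. \<Sum>i<n. X i \<omega>"
    have "indep_var borel (X n) borel ?S"
      by (rule indep_vars_sum) (auto intro: indep_vars_subset[OF indep])
    note cross = indep_var_lebesgue_integral[OF this int[of n]] indep_var_integrable[OF this int[of n]]
    have intS: "integrable M ?S" using int by simp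
    have eq: "(\<Sum>i<Suc n. X i \<omega>)\<^sup>2 = ?S \<omega> ^ 2 + 2 * (X n \<omega> * ?S \<omega>) + (X n \<omega>)\<^sup>2" for \<omega>
      by (simp add: power2_eq_square algebra_simps)
    show ?case
      unfolding eq using Suc sq[of n] cross[OF intS] mean[of n] by simp
  qed simp
  then show "integrable M (\<lambda>\<omega>. (\<Sum>i<n. X i \<omega>)\<^sup>2)"
    and "expectation (\<lambda>\<omega>. (\<Sum>i<n. X i \<omega>)\<^sup>2) = (\<Sum>i<n. expectation (\<lambda>\<omega>. (X i \<omega>)\<^sup>2))"
    by blast+
qed

text \<open>Markov's inequality is applied to the squared norm of the sum. Expanding that norm in an
  orthonormal basis reduces its expectation to the scalar case, where variances add, and the total
  is n V.\<close>

lemma (in prob_space) prob_norm_mean_deviation_le: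
  fixes Z :: "nat \<Rightarrow> 'a \<Rightarrow> 'b::euclidean_space"
  assumes indep: "indep_vars (\<lambda>_. borel) Z UNIV"
    and mean: "\<And>n. expectation (Z n) = 0"
    and int: "\<And>n. integrable M (Z n)"
    and sq: "\<And>n. integrable M (\<lambda>\<omega>. (norm (Z n \<omega>))\<^sup>2)"
    and V: "\<And>n. expectation (\<lambda>\<omega>. (norm (Z n \<omega>))\<^sup>2) = V"
    and a: "a > 0" and n: "n > 0"
  shows "prob {\<omega>\<in>space M. a \<le> norm ((\<Sum>i<n. Z i \<omega>) /\<^sub>R sqrt n)} \<le> V / a\<^sup>2"
proof -
  have meas[measurable]: "Z n \<in> borel_measurable M" for n
    using indep by (auto simp: indep_vars_def)
  have sqb: "integrable M (\<lambda>\<omega>. (Z n \<omega> \<bullet> b)\<^sup>2)" if "b \<in> Basis" for n b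
  proof (rule Bochner_Integration.integrable_bound[OF sq[of n]])
    show "AE \<omega> in M. norm ((Z n \<omega> \<bullet> b)\<^sup>2) \<le> norm ((norm (Z n \<omega>))\<^sup>2)"
      using Basis_le_norm[OF that] by (auto simp: abs_le_square_iff[symmetric])
  qed simp
  have ind: "indep_vars (\<lambda>_. borel) (\<lambda>n \<omega>. Z n \<omega> \<bullet> b) UNIV" for b
    by (rule indep_vars_compose2[OF indep]) simp
  have mb: "expectation (\<lambda>\<omega>. Z n \<omega> \<bullet> b) = 0" for n b
    using int[of n] mean[of n] by simp
  note sm = second_moment_sum[OF ind mb sqb]
  have norm_sq: "(norm z)\<^sup>2 = (\<Sum>b\<in>Basis. (z \<bullet> b)\<^sup>2)" for z :: 'b
    unfolding power2_norm_eq_inner by (subst euclidean_inner) (simp add: power2_eq_square)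
  have eq: "(norm (\<Sum>i<n. Z i \<omega>))\<^sup>2 = (\<Sum>b\<in>Basis. (\<Sum>i<n. Z i \<omega> \<bullet> b)\<^sup>2)" for \<omega>
    by (simp only: norm_sq inner_sum_left)
  have I: "integrable M (\<lambda>\<omega>. (norm (\<Sum>i<n. Z i \<omega>))\<^sup>2)"
    unfolding eq by (intro Bochner_Integration.integrable_sum sm(1))
  have "expectation (\<lambda>\<omega>. (norm (\<Sum>i<n. Z i \<omega>))\<^sup>2)
    = (\<Sum>b\<in>Basis. expectation (\<lambda>\<omega>. (\<Sum>i<n. Z i \<omega> \<bullet> b)\<^sup>2))"
    unfolding eq by (intro Bochner_Integration.integral_sum sm(1))
  also have "\<dots> = (\<Sum>b\<in>Basis. \<Sum>i<n. expectation (\<lambda>\<omega>. (Z i \<omega> \<bullet> b)\<^sup>2))"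
    by (intro sum.cong refl sm(2))
  also have "\<dots> = (\<Sum>i<n. \<Sum>b\<in>Basis. expectation (\<lambda>\<omega>. (Z i \<omega> \<bullet> b)\<^sup>2))"
    by (rule sum.swap)
  also have "\<dots> = (\<Sum>i<n. expectation (\<lambda>\<omega>. (norm (Z i \<omega>))\<^sup>2))"
    unfolding norm_sq by (intro sum.cong refl Bochner_Integration.integral_sum[symmetric] sqb)
  finally have E: "expectation (\<lambda>\<omega>. (norm (\<Sum>i<n. Z i \<omega>))\<^sup>2) = n * V"
    by (simp add: V)
  have set: "{\<omega>\<in>space M. a \<le> norm ((\<Sum>i<n. Z i \<omega>) /\<^sub>R sqrt n)}
    = {\<omega>\<in>space M. a\<^sup>2 * n \<le> (norm (\<Sum>i<n. Z i \<omega>))\<^sup>2}"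
  proof -
    have *: "a \<le> x / sqrt n \<longleftrightarrow> a\<^sup>2 * n \<le> x\<^sup>2" if "x \<ge> 0" for x
    proof -
      have "a \<le> x / sqrt n \<longleftrightarrow> a * sqrt n \<le> x" using n by (simp add: field_simps)
      also have "\<dots> \<longleftrightarrow> (a * sqrt n)\<^sup>2 \<le> x\<^sup>2" using that a by (simp add: abs_le_square_iff[symmetric])
      finally show ?thesis by (simp add: power_mult_distrib)
    qed
    have "a \<le> norm ((\<Sum>i<n. Z i \<omega>) /\<^sub>R sqrt n) \<longleftrightarrow> a\<^sup>2 * n \<le> (norm (\<Sum>i<n. Z i \<omega>))\<^sup>2" for \<omega>
      using *[of "norm (\<Sum>i<n. Z i \<omega>)"] by (simp add: divide_inverse mult.commute)
    then show ?thesis by simp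
  qed
  have "prob {\<omega>\<in>space M. a\<^sup>2 * n \<le> (norm (\<Sum>i<n. Z i \<omega>))\<^sup>2} \<le> n * V / (a\<^sup>2 * n)"
    unfolding E[symmetric] by (rule integral_Markov_inequality_measure[OF I, where A="{}"]) (use a n in auto)
  then show ?thesis unfolding set using n by simp
qed

text \<open>
  If the remainder of the linearisation at \<open>\<theta>\<close> is at most \<open>e\<close> times the distance within
  radius \<open>\<delta>\<close>, then for \<open>n \<ge> (\<eta> / (e \<delta>))\<^sup>2\<close> the scaled remainder exceeds \<open>\<eta>\<close> only if the scaled
  deviation of the mean is at least \<open>\<eta> / e\<close>; Chebyshev's inequality bounds the probability of that
  by a multiple of \<open>e\<^sup>2\<close>.
\<close>

theorem (in prob_space) delta_method:
  fixes Z :: "nat \<Rightarrow> 'a \<Rightarrow> 'b::euclidean_space" and F :: "'b \<Rightarrow> real"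
  assumes indep: "indep_vars (\<lambda>_. borel) Z UNIV"
    and distrib: "\<And>n. distr M borel (Z n) = \<nu>"
    and sq: "integrable M (\<lambda>\<omega>. (norm (Z 0 \<omega>))\<^sup>2)"
    and \<theta>: "\<theta> = expectation (Z 0)"
    and F[measurable]: "F \<in> borel_measurable borel"
    and deriv: "(F has_derivative F') (at \<theta>)"
  shows "weak_conv_m
    (\<lambda>n. distr M borel (\<lambda>\<omega>. sqrt (real n) * (F ((1 / real n) *\<^sub>R (\<Sum>i<n. Z i \<omega>)) - F \<theta>)))
    (normal_law 0 (expectation (\<lambda>\<omega>. (F' (Z 0 \<omega> - \<theta>))\<^sup>2)))"
proof -
  have meas[measurable]: "Z n \<in> borel_measurable M" for n
    using indep by (auto simp: indep_vars_def)
  have bl: "bounded_linear F'" using deriv by (rule has_derivative_bounded_linear)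
  interpret F': bounded_linear F' by (rule bl)
  have F'm[measurable]: "F' \<in> borel_measurable borel"
    by (rule borel_measurable_continuous_onI) (rule F'.continuous_on, rule continuous_on_id)
  have int0: "integrable M (Z 0)"
  proof -
    have "integrable M (\<lambda>\<omega>. norm (Z 0 \<omega>))"
      by (rule square_integrable_imp_integrable) (use sq in auto)
    then show ?thesis by (rule integrable_norm_cancel) simp
  qed
  define W where "W = (\<lambda>n \<omega>. Z n \<omega> - \<theta>)"
  have Wm[measurable]: "W n \<in> borel_measurable M" for n by (simp add: W_def)
  have W_indep: "indep_vars (\<lambda>_. borel) W UNIV"
    unfolding W_def by (rule indep_vars_compose2[OF indep]) simp
  have W_distr: "distr M borel (W n) = distr \<nu> borel (\<lambda>z. z - \<theta>)" for n
    unfolding distrib[of n, symmetric] W_def by (subst distr_distr) (auto simp: comp_def)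
  have W_int0: "integrable M (W 0)" and W_mean0: "expectation (W 0) = 0"
    using int0 by (auto simp: W_def \<theta> prob_space)
  have W_sq0: "integrable M (\<lambda>\<omega>. (norm (W 0 \<omega>))\<^sup>2)"
    unfolding W_def power2_norm_eq_inner inner_diff_left inner_diff_right
    using sq int0 by (simp add: power2_norm_eq_inner)
  have W_same: "distr M borel (W n) = distr M borel (W 0)" for n by (simp add: W_distr)
  have W_int: "integrable M (W n)" for n
    using W_int0 integrable_eq_if_distr_eq[OF W_same Wm Wm, of "\<lambda>x. x" n] by simp
  have W_mean: "expectation (W n) = 0" for n
    using W_mean0 integral_eq_if_distr_eq[OF W_same Wm Wm, of "\<lambda>x. x" n] by simp
  have W_sq: "integrable M (\<lambda>\<omega>. (norm (W n \<omega>))\<^sup>2)" for n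
    using W_sq0 integrable_eq_if_distr_eq[OF W_same Wm Wm, of "\<lambda>x. (norm x)\<^sup>2" n] by simp
  define V where "V = expectation (\<lambda>\<omega>. (norm (W 0 \<omega>))\<^sup>2)"
  have W_V: "expectation (\<lambda>\<omega>. (norm (W n \<omega>))\<^sup>2) = V" for n
    unfolding V_def by (rule integral_eq_if_distr_eq[OF W_same Wm Wm]) simp
  have "V \<ge> 0" unfolding V_def by (rule integral_nonneg_AE) simp
  note cheb = prob_norm_mean_deviation_le[OF W_indep W_mean W_int W_sq W_V]

  define A where "A = (\<lambda>n \<omega>. (\<Sum>i<n. F' (W i \<omega>)) / sqrt (real n))"
  define mn where "mn = (\<lambda>n \<omega>. (1 / real n) *\<^sub>R (\<Sum>i<n. Z i \<omega>))"
  have mnm[measurable]: "mn n \<in> borel_measurable M" for n by (simp add: mn_def)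
  define R where "R = (\<lambda>z. F z - F \<theta> - F' (z - \<theta>))"
  have Rm[measurable]: "R \<in> borel_measurable borel" by (simp add: R_def)
  define B where "B = (\<lambda>n \<omega>. sqrt (real n) * R (mn n \<omega>))"
  have L: "real_distribution (normal_law 0 (expectation (\<lambda>\<omega>. (F' (W 0 \<omega>))\<^sup>2)))"
    by (rule real_distribution_normal_law) (rule integral_nonneg_AE, simp)
  have dev: "sqrt (real n) *\<^sub>R (mn n \<omega> - \<theta>) = (\<Sum>i<n. W i \<omega>) /\<^sub>R sqrt n" if "n > 0" for n \<omega>
  proof -
    have "(\<Sum>i<n. W i \<omega>) = real n *\<^sub>R (mn n \<omega> - \<theta>)"
      using that by (simp add: W_def mn_def sum_subtractf scaleR_diff_right scaleR_left.sum[symmetric] sum_constant_scaleR)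
    then show ?thesis using that
      by (simp add: divide_inverse[symmetric] real_div_sqrt mult.commute)
  qed
  \<comment> \<open>\<open>A\<close> is the linear part, to which the central limit theorem applies,
    and \<open>B\<close> is the scaled remainder. For n = 0 both sides are 0.\<close>
  have decomp: "sqrt (real n) * (F (mn n \<omega>) - F \<theta>) = A n \<omega> + B n \<omega>" for n \<omega>
  proof (cases "n = 0")
    case False
    have "A n \<omega> = F' ((\<Sum>i<n. W i \<omega>) /\<^sub>R sqrt n)"
      by (simp add: A_def F'.scaleR F'.sum divide_inverse mult.commute)
    also have "\<dots> = sqrt n * F' (mn n \<omega> - \<theta>)"
      using dev[of n \<omega>] False F'.scaleR[of "sqrt n" "mn n \<omega> - \<theta>"] by simp
    finally show ?thesis by (simp add: B_def R_def algebra_simps)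
  qed (simp add: A_def B_def)

  have convA: "weak_conv_m (\<lambda>n. distr M borel (A n)) (normal_law 0 (expectation (\<lambda>\<omega>. (F' (W 0 \<omega>))\<^sup>2)))"
    unfolding A_def
  proof (rule central_limit_theorem_normal_law)
    show "indep_vars (\<lambda>_. borel) (\<lambda>i \<omega>. F' (W i \<omega>)) UNIV"
      by (rule indep_vars_compose2[OF W_indep]) simp
    show "distr M borel (\<lambda>\<omega>. F' (W n \<omega>)) = distr (distr \<nu> borel (\<lambda>z. z - \<theta>)) borel F'" for n
      unfolding W_distr[of n, symmetric] by (subst distr_distr) (auto simp: comp_def)
    show "expectation (\<lambda>\<omega>. F' (W 0 \<omega>)) = 0"
      using integral_bounded_linear[OF bl W_int0] W_mean0 by (simp add: F'.zero)
    obtain C where C: "\<And>x. norm (F' x) \<le> norm x * C" using F'.bounded by blast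
    show "integrable M (\<lambda>\<omega>. (F' (W 0 \<omega>))\<^sup>2)"
    proof (rule Bochner_Integration.integrable_bound)
      show "integrable M (\<lambda>\<omega>. C\<^sup>2 * (norm (W 0 \<omega>))\<^sup>2)" using W_sq0 by simp
      have "(F' x)\<^sup>2 \<le> C\<^sup>2 * (norm x)\<^sup>2" for x
        using power_mono[OF C[of x], of 2] by (simp add: power_mult_distrib mult.commute)
      then show "AE \<omega> in M. norm ((F' (W 0 \<omega>))\<^sup>2) \<le> norm (C\<^sup>2 * (norm (W 0 \<omega>))\<^sup>2)" by simp
    qed simp
  qed

  have "weak_conv_m (\<lambda>n. distr M borel (\<lambda>\<omega>. A n \<omega> + B n \<omega>)) (normal_law 0 (expectation (\<lambda>\<omega>. (F' (W 0 \<omega>))\<^sup>2)))"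
  proof (rule weak_conv_m_add_null[OF _ _ L convA])
    show "A n \<in> borel_measurable M" "B n \<in> borel_measurable M" for n
      by (simp_all add: A_def B_def)
    fix \<eta> :: real assume \<eta>: "\<eta> > 0"
    show "(\<lambda>n. prob {\<omega>\<in>space M. \<eta> < \<bar>B n \<omega>\<bar>}) \<longlonglongrightarrow> 0"
    proof (rule tendstoI)
      fix \<epsilon> :: real assume \<epsilon>: "\<epsilon> > 0"
      \<comment> \<open>With this choice the Chebyshev bound V / (\<eta>/e)^2 equals \<epsilon> V /
        (2 (V + 1)), which is below \<epsilon>. The \<open>V + 1\<close> keeps the denominator
        positive when V = 0.\<close>
      define e where "e = \<eta> * sqrt (\<epsilon> / (2 * (V + 1)))"
      have e: "e > 0" using \<eta> \<epsilon> \<open>V \<ge> 0\<close> by (simp add: e_def)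
      have small: "V / (\<eta> / e)\<^sup>2 < \<epsilon>"
      proof -
        have "V / (\<eta> / e)\<^sup>2 = V * (\<epsilon> / (2 * (V + 1)))"
          using \<eta> \<epsilon> \<open>V \<ge> 0\<close> by (simp add: e_def power_divide power_mult_distrib)
        also have "\<dots> = (V / (2 * (V + 1))) * \<epsilon>" by simp
        also have "\<dots> < 1 * \<epsilon>" using \<epsilon> \<open>V \<ge> 0\<close> by (intro mult_strict_right_mono) auto
        finally show ?thesis by simp
      qed
      obtain \<delta> where \<delta>: "\<delta> > 0" and R: "\<And>z. norm (z - \<theta>) < \<delta> \<Longrightarrow> \<bar>R z\<bar> \<le> e * norm (z - \<theta>)"
        using deriv e unfolding has_derivative_within_alt R_def by force
      obtain n0 :: nat where n0: "(\<eta> / (e * \<delta>))\<^sup>2 < n0" using reals_Archimedean2 by blast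
      show "\<forall>\<^sub>F n in sequentially. dist (prob {\<omega>\<in>space M. \<eta> < \<bar>B n \<omega>\<bar>}) 0 < \<epsilon>"
      proof (rule eventually_sequentiallyI)
        fix n assume "n \<ge> max 1 n0"
        then have n: "n > 0" "(\<eta> / (e * \<delta>))\<^sup>2 < n" using n0 by auto
        have "\<eta> / (e * \<delta>) < sqrt n" using n(2) by (rule real_less_rsqrt)
        then have big: "\<eta> / e \<le> sqrt n * \<delta>" using e \<delta> by (simp add: field_simps)
        have "{\<omega>\<in>space M. \<eta> < \<bar>B n \<omega>\<bar>} \<subseteq> {\<omega>\<in>space M. \<eta> / e \<le> norm ((\<Sum>i<n. W i \<omega>) /\<^sub>R sqrt n)}"
        proof (intro subsetI CollectI conjI; elim CollectE conjE)
          fix \<omega> assume B: "\<eta> < \<bar>B n \<omega>\<bar>"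
          have nrm: "norm ((\<Sum>i<n. W i \<omega>) /\<^sub>R sqrt n) = sqrt n * norm (mn n \<omega> - \<theta>)"
            using dev[OF n(1), of \<omega>] by (metis abs_of_nonneg norm_scaleR of_nat_0_le_iff real_sqrt_ge_zero)
          show "\<eta> / e \<le> norm ((\<Sum>i<n. W i \<omega>) /\<^sub>R sqrt n)"
          proof (cases "norm (mn n \<omega> - \<theta>) < \<delta>")
            case True
            have "\<bar>B n \<omega>\<bar> = sqrt n * \<bar>R (mn n \<omega>)\<bar>" by (simp add: B_def abs_mult)
            also have "\<dots> \<le> sqrt n * (e * norm (mn n \<omega> - \<theta>))" using R[OF True] by (simp add: mult_left_mono)
            finally show ?thesis using B e unfolding nrm by (simp add: field_simps)
          next
            case False
            then have "sqrt n * \<delta> \<le> sqrt n * norm (mn n \<omega> - \<theta>)" by (simp add: mult_left_mono)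
            then show ?thesis using big unfolding nrm by linarith
          qed
        qed
        then have "prob {\<omega>\<in>space M. \<eta> < \<bar>B n \<omega>\<bar>} \<le> prob {\<omega>\<in>space M. \<eta> / e \<le> norm ((\<Sum>i<n. W i \<omega>) /\<^sub>R sqrt n)}"
          by (rule finite_measure_mono) simp
        also have "\<dots> \<le> V / (\<eta> / e)\<^sup>2" by (rule cheb) (use \<eta> e n in auto)
        finally show "dist (prob {\<omega>\<in>space M. \<eta> < \<bar>B n \<omega>\<bar>}) 0 < \<epsilon>" using small by simp
      qed
    qed
  qed
  then show ?thesis
    unfolding decomp[symmetric] by (simp add: mn_def W_def)
qed

section \<open>The derivative of the spectral likelihood\<close>

lemma matrix_inv:
  fixes A :: "real ^ 'n ^ 'n"
  assumes "invertible A"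
  shows matrix_mul_matrix_inv: "A ** matrix_inv A = mat 1"
    and matrix_inv_mul_matrix: "matrix_inv A ** A = mat 1"
proof -
  have "A ** matrix_inv A = mat 1 \<and> matrix_inv A ** A = mat 1"
    using assms unfolding invertible_def matrix_inv_def by (rule someI_ex)
  then show "A ** matrix_inv A = mat 1" "matrix_inv A ** A = mat 1" by auto
qed

lemma bounded_bilinear_matrix_matrix_mult:
  "bounded_bilinear ((**) :: real ^ 'n ^ 'm \<Rightarrow> real ^ 'p ^ 'n \<Rightarrow> real ^ 'p ^ 'm)"
  unfolding bilinear_conv_bounded_bilinear[symmetric] bilinear_def
  by (intro conjI allI linearI;
      simp add: vec_eq_iff matrix_matrix_mult_def distrib_left distrib_right sum.distrib;
      simp add: sum_distrib_left mult.left_commute mult.assoc)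

lemma bounded_bilinear_matrix_vector_mult:
  "bounded_bilinear ((*v) :: real ^ 'n ^ 'm \<Rightarrow> real ^ 'n \<Rightarrow> real ^ 'm)"
  unfolding bilinear_conv_bounded_bilinear[symmetric] bilinear_def
  by (intro conjI allI linearI;
      simp add: vec_eq_iff matrix_vector_mult_def distrib_left distrib_right sum.distrib;
      simp add: sum_distrib_left mult.left_commute mult.assoc)

lemma linear_tensor_apply: "linear (\<lambda>K. tensor_apply K a)"
  by (rule linearI; simp add: vec_eq_iff tensor_apply_def distrib_left distrib_right sum.distrib;
      simp add: sum_distrib_left mult.left_commute mult.assoc)

lemma continuous_on_det [continuous_intros]:
  fixes f :: "'a::topological_space \<Rightarrow> real ^ 'n ^ 'n"
  assumes "continuous_on S f"
  shows "continuous_on S (\<lambda>x. det (f x))"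
  unfolding det_def
  by (intro continuous_on_sum continuous_on_mult continuous_on_const continuous_on_prod
      continuous_on_component assms)

lemma open_invertible: "open {A :: real ^ 'n ^ 'n. invertible A}"
proof -
  have "open {A :: real ^ 'n ^ 'n. det A \<noteq> 0}"
    by (intro open_Collect_neq continuous_on_det continuous_on_id continuous_on_const)
  then show ?thesis by (simp add: invertible_det_nz)
qed

text \<open>Column \<open>j\<close> of the inverse solves A z = e_j, so Cramer's rule gives its
  entries. As quotients of determinants they are visibly continuous where \<open>A\<close> is
  invertible.\<close>

lemma matrix_inv_component_cramer:
  fixes A :: "real ^ 'n ^ 'n"
  assumes "invertible A"
  shows "matrix_inv A $ i $ j = det (\<chi> k l. if l = i then axis j 1 $ k else A $ k $ l) / det A"
proof -
  have "A *v (matrix_inv A *v axis j 1) = axis j 1"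
    using matrix_mul_matrix_inv[OF assms] by (simp add: matrix_vector_mul_assoc)
  then have "matrix_inv A *v axis j 1 = (\<chi> i. det (\<chi> k l. if l = i then axis j 1 $ k else A $ k $ l) / det A)"
    using assms by (simp add: cramer invertible_det_nz)
  then show ?thesis
    by (simp add: vec_eq_iff matrix_vector_mult_basis column_def)
qed

lemma continuous_on_matrix_inv: "continuous_on {A :: real ^ 'n ^ 'n. invertible A} matrix_inv"
proof -
  have "continuous_on {A. invertible A}
    (\<lambda>A :: real ^ 'n ^ 'n. \<chi> i j. det (\<chi> k l. if l = i then axis j 1 $ k else A $ k $ l) / det A)"
  proof (intro continuous_on_vec_lambda continuous_on_divide continuous_on_det continuous_on_id)
    show "continuous_on {A. invertible A} (\<lambda>A :: real ^ 'n ^ 'n. if l = i then axis j 1 $ k else A $ k $ l)"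
      for i j k l :: 'n
      by (cases "l = i") (auto intro!: continuous_on_const continuous_on_component continuous_on_id)
  qed (auto simp: invertible_det_nz)
  then show ?thesis
    by (rule continuous_on_eq) (auto simp: vec_eq_iff matrix_inv_component_cramer)
qed

text \<open>From the exact identity A^-1 - S^-1 = - A^-1 (A - S) S^-1, the linearisation error is
  (S^-1 - A^-1) (A - S) S^-1. After division by the norm of A - S it tends to 0, because inversion
  is continuous at \<open>S\<close>.\<close>

lemma has_derivative_matrix_inv:
  fixes S :: "real ^ 'n ^ 'n"
  assumes S: "invertible S"
  shows "(matrix_inv has_derivative (\<lambda>H. - (matrix_inv S ** H ** matrix_inv S))) (at S)"
proof -
  interpret mm: bounded_bilinear "(**) :: real ^ 'n ^ 'n \<Rightarrow> real ^ 'n ^ 'n \<Rightarrow> real ^ 'n ^ 'n"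
    by (rule bounded_bilinear_matrix_matrix_mult)
  obtain C where C: "C > 0" "\<And>(A :: real ^ 'n ^ 'n) (B :: real ^ 'n ^ 'n). norm (A ** B) \<le> norm A * norm B * C"
    using mm.pos_bounded by blast
  let ?i = "matrix_inv S"
  obtain e where e: "e > 0" "\<And>A. dist A S < e \<Longrightarrow> invertible A"
    using open_invertible[unfolded open_dist, rule_format, of S] S by auto
  show ?thesis
  proof (rule has_derivativeI_sandwich[OF e(1)])
    show "bounded_linear (\<lambda>H. - (?i ** H ** ?i))"
      by (intro bounded_linear_minus bounded_linear_compose[OF mm.bounded_linear_left] mm.bounded_linear_right)
    show "((\<lambda>A. norm (?i - matrix_inv A) * C * norm ?i * C) \<longlongrightarrow> 0) (at S)"
    proof -
      have "(matrix_inv \<longlongrightarrow> ?i) (at S)"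
        using continuous_on_matrix_inv[unfolded continuous_on_eq_continuous_at[OF open_invertible]] S
        unfolding isCont_def by blast
      then have "((\<lambda>A. norm (?i - matrix_inv A) * C * norm ?i * C) \<longlongrightarrow> norm (?i - ?i) * C * norm ?i * C) (at S)"
        by (intro tendsto_intros)
      then show ?thesis by simp
    qed
    fix A assume "A \<noteq> S" "dist A S < e"
    then have A: "invertible A" and pos: "norm (A - S) > 0" using e by auto
    let ?a = "matrix_inv A"
    have "?a - ?i = ?a ** (S ** ?i) - (?a ** A) ** ?i"
      using matrix_mul_matrix_inv[OF S] matrix_inv_mul_matrix[OF A] by simp
    also have "\<dots> = - (?a ** (A - S) ** ?i)"
      by (simp add: mm.diff_left mm.diff_right matrix_mul_assoc)
    finally have "?a - ?i - - (?i ** (A - S) ** ?i) = (?i - ?a) ** (A - S) ** ?i"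
      by (simp add: mm.diff_left)
    also have "norm \<dots> \<le> norm (?i - ?a) * norm (A - S) * C * norm ?i * C"
    proof -
      have "norm ((?i - ?a) ** (A - S) ** ?i) \<le> norm ((?i - ?a) ** (A - S)) * norm ?i * C"
        by (rule C(2))
      also have "\<dots> \<le> norm (?i - ?a) * norm (A - S) * C * norm ?i * C"
        using C by (intro mult_right_mono) auto
      finally show ?thesis .
    qed
    finally show "norm (?a - ?i - - (?i ** (A - S) ** ?i)) / norm (A - S)
        \<le> norm (?i - ?a) * C * norm ?i * C"
      using pos by (simp add: divide_le_eq mult_ac)
  qed
qed

section \<open>The derivative of the chain of operators\<close>

lemma spectral_chain_empty: "t < s \<Longrightarrow> spectral_chain S K y s t = matrix_inv S"
  by (simp add: spectral_chain_def)

text \<open>The case \<open>s = Suc t\<close> is included: the chain being extended is then the bare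
  \<open>matrix_inv S\<close>.\<close>

lemma spectral_chain_Suc:
  "s \<le> Suc t \<Longrightarrow> spectral_chain S K y s (Suc t) = matrix_inv S ** tensor_apply K (y (Suc t)) ** spectral_chain S K y s t"
  by (simp add: spectral_chain_def)

text \<open>Varying K(y_r) leaves the chain after r on its left and the chain before r on its right.
  Varying one of the t + 1 inverses replaces it by - S^-1 dS S^-1, and each copy of S^-1 closes one
  of the two adjacent chains; hence the second sum starts at 0. The proof is the product rule along
  the recursion in \<open>t\<close>.\<close>

lemma has_derivative_spectral_chain:
  fixes S :: "real ^ 'd ^ 'd" and K :: "real ^ 'd ^ 'd ^ 'd" and y :: "nat \<Rightarrow> real ^ 'd"
  assumes S: "invertible S"
  defines "C \<equiv> spectral_chain S K y"
  shows "((\<lambda>(S, K). spectral_chain S K y 1 t) has_derivative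
    (\<lambda>(dS, dK). (\<Sum>r\<in>{1..t}. C (r + 1) t ** tensor_apply dK (y r) ** C 1 (r - 1))
      - (\<Sum>r\<in>{0..t}. C (r + 1) t ** dS ** C 1 r))) (at (S, K))"
proof (induction t)
  interpret mm: bounded_bilinear "(**) :: real ^ 'd ^ 'd \<Rightarrow> real ^ 'd ^ 'd \<Rightarrow> real ^ 'd ^ 'd"
    by (rule bounded_bilinear_matrix_matrix_mult)
  have inv: "((\<lambda>p. matrix_inv (fst p)) has_derivative (\<lambda>dp. - (matrix_inv S ** fst dp ** matrix_inv S)))
      (at (S, K))" for K :: "real ^ 'd ^ 'd ^ 'd"
  proof -
    have "(matrix_inv has_derivative (\<lambda>H. - (matrix_inv S ** H ** matrix_inv S))) (at (fst (S, K)))"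
      using has_derivative_matrix_inv[OF S] by simp
    from has_derivative_compose[OF bounded_linear_imp_has_derivative[OF bounded_linear_fst] this]
    show ?thesis .
  qed
  {
    case 0
    show ?case
      using inv[of K] by (simp add: case_prod_beta' C_def spectral_chain_empty)
  next
    case (Suc t)
    let ?i = "matrix_inv S" and ?k = "tensor_apply K (y (Suc t))"
    let ?D = "\<lambda>dp. (\<Sum>r\<in>{1..t}. C (r + 1) t ** tensor_apply (snd dp) (y r) ** C 1 (r - 1))
      - (\<Sum>r\<in>{0..t}. C (r + 1) t ** fst dp ** C 1 r)"
    have tens: "((\<lambda>p :: (real ^ 'd ^ 'd) \<times> (real ^ 'd ^ 'd ^ 'd). tensor_apply (snd p) (y (Suc t)))
        has_derivative (\<lambda>dp. tensor_apply (snd dp) (y (Suc t)))) (at (S, K))"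
      by (intro bounded_linear_imp_has_derivative linear_conv_bounded_linear[THEN iffD1]
          linear_compose[OF linear_snd linear_tensor_apply, unfolded comp_def])
    have IH: "((\<lambda>p. spectral_chain (fst p) (snd p) y 1 t) has_derivative ?D) (at (S, K))"
      using Suc.IH by (simp add: case_prod_beta')
    \<comment> \<open>Going from \<open>t\<close> to \<open>Suc t\<close> prolongs every left-hand
      chain of the old terms by one factor. \<open>C1\<close> and \<open>C2\<close> serve the new
      terms with index \<open>Suc t\<close>, whose left-hand chain is a single inverse.\<close>
    have step: "?i ** (?k ** (C (Suc r) t ** A)) = C (Suc r) (Suc t) ** A" if "r \<le> t" for r A
      using that by (simp add: C_def spectral_chain_Suc matrix_mul_assoc)
    have C1: "C (Suc 0) (Suc t) = ?i ** ?k ** C (Suc 0) t"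
      by (simp add: C_def spectral_chain_Suc)
    have C2: "C (Suc (Suc t)) (Suc t) = ?i"
      by (simp add: C_def spectral_chain_empty)
    have "((\<lambda>p. matrix_inv (fst p) ** tensor_apply (snd p) (y (Suc t)) ** spectral_chain (fst p) (snd p) y 1 t)
      has_derivative (\<lambda>dp. ?i ** ?k ** ?D dp
        + (?i ** tensor_apply (snd dp) (y (Suc t)) + - (?i ** fst dp ** ?i) ** ?k) ** C 1 t)) (at (S, K))"
      using mm.FDERIV[OF mm.FDERIV[OF inv tens] IH] by (simp add: C_def)
    moreover have "?i ** ?k ** ?D dp + (?i ** tensor_apply (snd dp) (y (Suc t)) + - (?i ** fst dp ** ?i) ** ?k) ** C 1 t
      = (\<Sum>r\<in>{1..Suc t}. C (r + 1) (Suc t) ** tensor_apply (snd dp) (y r) ** C 1 (r - 1))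
        - (\<Sum>r\<in>{0..Suc t}. C (r + 1) (Suc t) ** fst dp ** C 1 r)" for dp
    proof -
      have "?i ** ?k ** ?D dp = (\<Sum>r\<in>{1..t}. C (r + 1) (Suc t) ** tensor_apply (snd dp) (y r) ** C 1 (r - 1))
        - (\<Sum>r\<in>{0..t}. C (r + 1) (Suc t) ** fst dp ** C 1 r)"
        unfolding mm.diff_right mm.sum_right
        by (intro arg_cong2[where f="(-)"] sum.cong refl) (simp_all add: step matrix_mul_assoc[symmetric])
      then show ?thesis
        by (simp add: C1 C2 mm.add_left mm.minus_left mm.diff_left matrix_mul_assoc)
    qed
    ultimately show ?case
      by (simp only: spectral_chain_Suc case_prod_beta' le_add1 plus_1_eq_Suc One_nat_def Suc_le_mono le0)
  }
qed

section \<open>Pairing the stacked vector \<beta> with increments of the moments\<close>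

lemma sum_UNIV_Plus:
  "(\<Sum>i\<in>UNIV. f i) = (\<Sum>a\<in>UNIV. f (Inl a)) + (\<Sum>b\<in>UNIV. f (Inr b))"
  for f :: "'a::finite + 'b::finite \<Rightarrow> real"
  unfolding UNIV_Plus_UNIV[symmetric] by (subst sum.Plus) auto

lemma inner_stack3: "stack3 u w z \<bullet> stack3 u' w' z' = u \<bullet> u' + w \<bullet> w' + z \<bullet> z'"
  by (simp add: inner_vec_def stack3_def sum_UNIV_Plus)

lemma inner_flatten2: "flatten2 A \<bullet> flatten2 B = A \<bullet> B"
  by (simp add: inner_vec_def flatten2_def sum.cartesian_product UNIV_Times_UNIV[symmetric] split_def
      del: UNIV_Times_UNIV)

lemma inner_flatten3: "flatten3 A \<bullet> flatten3 B = A \<bullet> B"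
  by (simp add: inner_vec_def flatten3_def sum.cartesian_product UNIV_Times_UNIV[symmetric] split_def
      del: UNIV_Times_UNIV)

text \<open>This and \<open>inner_outer3\<close> turn the outer products in \<beta> into bilinear
  forms u^T A w, the shape in which the product rule delivers the derivative.\<close>

lemma inner_outer2: "outer2 u w \<bullet> A = u \<bullet> (A *v w)"
  by (simp add: inner_vec_def outer2_def matrix_vector_mult_def sum_distrib_left mult_ac)

lemma inner_outer3: "outer3 u w z \<bullet> B = u \<bullet> (tensor_apply B z *v w)"
  by (simp add: inner_vec_def outer3_def tensor_apply_def matrix_vector_mult_def sum_distrib_left
      sum_distrib_right mult_ac)

text \<open>The derivative is computed on the product space of moment triples, whereas \<beta> and
  the covariance matrix live on stacked vectors; this linear map connects the two.\<close>

definition stack_moments ::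
    "(real ^ 'd) \<times> (real ^ 'd ^ 'd) \<times> (real ^ 'd ^ 'd ^ 'd) \<Rightarrow> real ^ ('d + ('d \<times> 'd) + ('d \<times> 'd \<times> 'd))" where
  "stack_moments = (\<lambda>(m, S, K). stack3 m (flatten2 S) (flatten3 K))"

lemma linear_stack_moments: "linear (stack_moments :: _ \<Rightarrow> real ^ ('d::finite + ('d \<times> 'd) + ('d \<times> 'd \<times> 'd)))"
  by (rule linearI) (auto simp: stack_moments_def stack3_def flatten2_def flatten3_def vec_eq_iff split: sum.split)

lemma linear_flatten2: "linear flatten2" and linear_flatten3: "linear flatten3"
  by (auto intro!: linearI simp: flatten2_def flatten3_def vec_eq_iff)

text \<open>Each row vector \<open>m v* C\<close> is moved across the inner product as the matrix
  \<open>C\<close>, so a pair of boundary vectors becomes one matrix product between two copies of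
  \<open>m\<close>. The vectors v and v' of \<beta> account for the two occurrences of the mean in
  the likelihood.\<close>

lemma inner_spectral_beta:
  fixes S :: "real ^ 'd ^ 'd" and K :: "real ^ 'd ^ 'd ^ 'd" and y :: "nat \<Rightarrow> real ^ 'd"
  defines "C \<equiv> spectral_chain S K y"
  shows "spectral_beta m S K y T \<bullet> stack_moments (dm, dS, dK) =
    dm \<bullet> (C 1 T *v m) + m \<bullet> (C 1 T *v dm)
    + (\<Sum>t\<in>{1..T}. m \<bullet> (C (t + 1) T ** tensor_apply dK (y t) ** C 1 (t - 1) *v m))
    - (\<Sum>t\<in>{0..T}. m \<bullet> (C (t + 1) T ** dS ** C 1 t *v m))"
  unfolding spectral_beta_def Let_def stack_moments_def prod.case inner_stack3 C_def
    linear_sum[OF linear_flatten2, symmetric] linear_sum[OF linear_flatten3, symmetric]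
    inner_minus_left inner_flatten2 inner_flatten3 inner_sum_left inner_outer2 inner_outer3
    dot_lmul_matrix inner_add_left matrix_vector_mul_assoc matrix_mul_assoc
  by (simp add: inner_commute)

text \<open>The product rule for m . (C m), with the derivative of the chain inserted, yields
  exactly the terms listed in \<open>inner_spectral_beta\<close>.\<close>

lemma has_derivative_spectral_likelihood:
  fixes S :: "real ^ 'd ^ 'd" and K :: "real ^ 'd ^ 'd ^ 'd" and y :: "nat \<Rightarrow> real ^ 'd"
  assumes S: "invertible S"
  shows "((\<lambda>(m, S, K). spectral_likelihood m S K y T) has_derivative
    (\<lambda>dp. spectral_beta m S K y T \<bullet> stack_moments dp)) (at (m, S, K))"
proof -
  interpret mv: bounded_bilinear "(*v) :: real ^ 'd ^ 'd \<Rightarrow> real ^ 'd \<Rightarrow> real ^ 'd"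
    by (rule bounded_bilinear_matrix_vector_mult)
  let ?C = "spectral_chain S K y"
  let ?D = "\<lambda>dp. (\<Sum>r\<in>{1..T}. ?C (r + 1) T ** tensor_apply (snd (snd dp)) (y r) ** ?C 1 (r - 1))
      - (\<Sum>r\<in>{0..T}. ?C (r + 1) T ** fst (snd dp) ** ?C 1 r)"
  have C: "((\<lambda>p. spectral_chain (fst (snd p)) (snd (snd p)) y 1 T) has_derivative ?D) (at (m, S, K))"
  proof -
    \<comment> \<open>The chain does not involve the mean, so its derivative is composed with
      \<open>snd\<close>; the 0 fills the slot of the mean increment, which \<open>?D\<close>
      ignores.\<close>
    have "((\<lambda>q. spectral_chain (fst q) (snd q) y 1 T) has_derivative (\<lambda>dq. ?D (0, dq))) (at (snd (m, S, K)))"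
      using has_derivative_spectral_chain[OF S, of y T K] by (simp add: case_prod_beta')
    from has_derivative_compose[OF bounded_linear_imp_has_derivative[OF bounded_linear_snd] this]
    show ?thesis by simp
  qed
  have f: "(fst has_derivative fst) (at (m, S, K))" by (auto intro!: derivative_eq_intros)
  from bounded_bilinear.FDERIV[OF bounded_bilinear_inner f mv.FDERIV[OF C f]]
  have "((\<lambda>p. fst p \<bullet> (spectral_chain (fst (snd p)) (snd (snd p)) y 1 T *v fst p)) has_derivative
    (\<lambda>dp. m \<bullet> (?C 1 T *v fst dp + ?D dp *v m) + fst dp \<bullet> (?C 1 T *v m))) (at (m, S, K))"
    by simp
  moreover have "m \<bullet> (?C 1 T *v fst dp + ?D dp *v m) + fst dp \<bullet> (?C 1 T *v m)
    = spectral_beta m S K y T \<bullet> stack_moments dp" for dp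
    using inner_spectral_beta[of m S K y T "fst dp" "fst (snd dp)" "snd (snd dp)"]
    by (simp add: mv.diff_left mv.sum_left inner_add_right inner_diff_right inner_sum_right)
  ultimately show ?thesis
    by (simp add: case_prod_beta' spectral_likelihood_def)
qed

section \<open>Measurability, finite-valued observations and the covariance form\<close>

text \<open>The likelihood is differentiable, hence continuous, on the open set of invertible
  \<open>S\<close>, and the function is constant elsewhere. This gives the measurability on the
  whole space that \<open>delta_method\<close> asks for.\<close>

lemma borel_measurable_spectral_likelihood:
  fixes y :: "nat \<Rightarrow> real ^ 'd"
  shows
  "(\<lambda>(m, S, K). if invertible S then spectral_likelihood m S K y T else c) \<in> borel_measurable borel"
proof -
  let ?A = "{p :: (real ^ 'd) \<times> (real ^ 'd ^ 'd) \<times> (real ^ 'd ^ 'd ^ 'd). invertible (fst (snd p))}"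
  let ?f = "\<lambda>(m, S, K). spectral_likelihood m S K y T"
  have A: "open ?A"
    using open_vimage[OF open_invertible, of "\<lambda>p. fst (snd p)"] by (simp add: vimage_def continuous_intros)
  have "continuous_on ?A ?f"
  proof (intro continuous_at_imp_continuous_on ballI)
    fix p assume "p \<in> ?A"
    then show "isCont ?f p"
      using has_derivative_continuous[OF has_derivative_spectral_likelihood] by (cases p) simp
  qed
  then have "(\<lambda>p. if p \<in> ?A then ?f p else c) \<in> borel_measurable borel"
    using A by (intro borel_measurable_continuous_on_if) auto
  moreover have "(\<lambda>p. if p \<in> ?A then ?f p else c)
    = (\<lambda>(m, S, K). if invertible S then spectral_likelihood m S K y T else c)"
    by (auto simp: fun_eq_iff)
  ultimately show ?thesis by (simp only:)
qed

text \<open>The contribution of a single triple to all three moments, so that the three estimators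
  together form one sample mean.\<close>

definition moment_observation ::
    "(real ^ 'd) \<times> (real ^ 'd) \<times> (real ^ 'd) \<Rightarrow> (real ^ 'd) \<times> (real ^ 'd ^ 'd) \<times> (real ^ 'd ^ 'd ^ 'd)" where
  "moment_observation = (\<lambda>(u1, u2, u3). (u1, outer2 u2 u1, outer3 u3 u1 u2))"

lemma borel_measurable_moment_observation: "moment_observation \<in> borel_measurable borel"
  unfolding moment_observation_def outer2_def outer3_def split_def
  by (intro borel_measurable_continuous_onI continuous_intros continuous_on_vec_lambda)

text \<open>On a finite set of values every function is bounded. All integrability over the Markov
  model comes from here.\<close>

lemma (in finite_measure) integrable_finite_values:
  fixes g :: "'b::second_countable_topology \<Rightarrow> 'c::{banach, second_countable_topology}"
  assumes [measurable]: "Z \<in> borel_measurable M" "g \<in> borel_measurable borel"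
    and "finite V" and V: "\<And>\<omega>. \<omega> \<in> space M \<Longrightarrow> Z \<omega> \<in> V"
  shows "integrable M (\<lambda>\<omega>. g (Z \<omega>))"
proof -
  have "bounded (g ` V)" using \<open>finite V\<close> by (simp add: finite_imp_bounded)
  then obtain B where "\<And>z. z \<in> V \<Longrightarrow> norm (g z) \<le> B" by (auto simp: bounded_iff)
  then show ?thesis using V by (intro integrable_const_bound[of _ B]) auto
qed

text \<open>Expanding the square over pairs of coordinates identifies the quadratic form with the
  variance of the scalar variable \<beta> . W.\<close>

lemma covariance_matrix_quadratic_form:
  fixes W :: "'w \<Rightarrow> real ^ 'n"
  assumes W: "integrable M W"
    and int: "\<And>i j. integrable M (\<lambda>\<omega>. (W \<omega> - integral\<^sup>L M W) $ i * (W \<omega> - integral\<^sup>L M W) $ j)"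
  shows "\<beta> \<bullet> (covariance_matrix M W *v \<beta>) = (LINT \<omega>|M. (\<beta> \<bullet> (W \<omega> - integral\<^sup>L M W))\<^sup>2)"
proof -
  have comp: "(LINT \<omega>|M. W \<omega> $ i) = integral\<^sup>L M W $ i" for i
    by (rule integral_bounded_linear[OF bounded_linear_vec_nth W])
  have sq: "(\<beta> \<bullet> v)\<^sup>2 = (\<Sum>i\<in>UNIV. \<Sum>j\<in>UNIV. (\<beta> $ i * \<beta> $ j) * (v $ i * v $ j))" for v
    by (simp add: inner_vec_def power2_eq_square sum_product mult_ac)
  have "(LINT \<omega>|M. (\<beta> \<bullet> (W \<omega> - integral\<^sup>L M W))\<^sup>2) = (\<Sum>i\<in>UNIV. \<Sum>j\<in>UNIV. (\<beta> $ i * \<beta> $ j) * covariance_matrix M W $ i $ j)"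
    unfolding sq using int
    by (simp add: Bochner_Integration.integral_sum covariance_matrix_def comp)
  also have "\<dots> = \<beta> \<bullet> (covariance_matrix M W *v \<beta>)"
    by (simp add: inner_vec_def matrix_vector_mult_def sum_distrib_left mult_ac)
  finally show ?thesis by simp
qed

section \<open>Asymptotic normality of the spectral estimate\<close>

theorem theorem1:
  fixes \<Omega> :: "'w measure"
    and h :: "nat \<Rightarrow> 'w \<Rightarrow> 'd::finite"
    and X :: "nat \<Rightarrow> 'w \<Rightarrow> real ^ 'p::finite"
    and \<pi> :: "real ^ 'd"
    and Tr :: "real ^ 'd ^ 'd"
    and emission :: "'d \<Rightarrow> 'p pmf"
    and U :: "real ^ 'd ^ 'p"
    and Y :: "nat \<Rightarrow> 'w \<Rightarrow> real ^ 'd"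
    and \<mu> :: "real ^ 'd" and \<Sigma> :: "real ^ 'd ^ 'd" and K :: "real ^ 'd ^ 'd ^ 'd"
    and \<Omega>' :: "'v measure"
    and Ys :: "nat \<Rightarrow> 'v \<Rightarrow> (real ^ 'd) \<times> (real ^ 'd) \<times> (real ^ 'd)"
    and \<mu>h :: "nat \<Rightarrow> 'v \<Rightarrow> real ^ 'd"
    and \<Sigma>h :: "nat \<Rightarrow> 'v \<Rightarrow> real ^ 'd ^ 'd"
    and Kh :: "nat \<Rightarrow> 'v \<Rightarrow> real ^ 'd ^ 'd ^ 'd"
    and T :: nat
    and x :: "nat \<Rightarrow> real ^ 'p"
    and y :: "nat \<Rightarrow> real ^ 'd"
    and c :: real
    and Pr :: real
    and Prh :: "nat \<Rightarrow> 'v \<Rightarrow> real"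
    and \<beta> :: "real ^ ('d + ('d \<times> 'd) + ('d \<times> 'd \<times> 'd))"
  assumes hmm: "hidden_markov_model \<Omega> h X \<pi> Tr emission"
    and U: "orthonormal_columns_spanning U (output_mean emission)"
    and Y: "\<And>t \<omega>. Y t \<omega> = transpose U *v X t \<omega>"
    and \<mu>: "\<mu> = (LINT \<omega>|\<Omega>. Y 1 \<omega>)"
    and \<Sigma>: "\<Sigma> = (LINT \<omega>|\<Omega>. outer2 (Y 2 \<omega>) (Y 1 \<omega>))"
    and K: "K = (LINT \<omega>|\<Omega>. outer3 (Y 3 \<omega>) (Y 1 \<omega>) (Y 2 \<omega>))"
    and invertible: "invertible \<Sigma>"
    and sample_space: "prob_space \<Omega>'"
    and independent: "prob_space.indep_vars \<Omega>' (\<lambda>_. borel) Ys {1..}"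
    and identically_distributed:
      "\<And>i. i \<ge> 1 \<Longrightarrow> distr \<Omega>' borel (Ys i) = distr \<Omega> borel (\<lambda>\<omega>. (Y 1 \<omega>, Y 2 \<omega>, Y 3 \<omega>))"
    and \<mu>h: "\<And>N \<omega>. \<mu>h N \<omega> = (1 / real N) *\<^sub>R (\<Sum>i\<in>{1..N}. case Ys i \<omega> of (u1, u2, u3) \<Rightarrow> u1)"
    and \<Sigma>h: "\<And>N \<omega>. \<Sigma>h N \<omega> =
      (1 / real N) *\<^sub>R (\<Sum>i\<in>{1..N}. case Ys i \<omega> of (u1, u2, u3) \<Rightarrow> outer2 u2 u1)"
    and Kh: "\<And>N \<omega>. Kh N \<omega> =
      (1 / real N) *\<^sub>R (\<Sum>i\<in>{1..N}. case Ys i \<omega> of (u1, u2, u3) \<Rightarrow> outer3 u3 u1 u2)"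
    and T: "T \<ge> 1"
    and x: "\<And>t. t \<in> {1..T} \<Longrightarrow> x t \<in> range (\<lambda>k. axis k 1)"
    and y: "\<And>t. y t = transpose U *v x t"
    and Pr: "Pr = spectral_likelihood \<mu> \<Sigma> K y T"
    and Prh: "\<And>N \<omega>. Prh N \<omega> =
      (if invertible (\<Sigma>h N \<omega>) then spectral_likelihood (\<mu>h N \<omega>) (\<Sigma>h N \<omega>) (Kh N \<omega>) y T else c)"
    and \<beta>: "\<beta> = spectral_beta \<mu> \<Sigma> K y T"
  shows "weak_conv_m
    (\<lambda>N. distr \<Omega>' borel (\<lambda>\<omega>. sqrt (real N) * (Prh N \<omega> - Pr)))
    (normal_law 0 (\<beta> \<bullet> (covariance_matrix \<Omega>
      (\<lambda>\<omega>. stack3 (Y 1 \<omega>) (flatten2 (outer2 (Y 2 \<omega>) (Y 1 \<omega>)))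
        (flatten3 (outer3 (Y 3 \<omega>) (Y 1 \<omega>) (Y 2 \<omega>)))) *v \<beta>)))"
proof -
  interpret H: hidden_markov_model \<Omega> h X \<pi> Tr emission by (rule hmm)
  interpret S: prob_space \<Omega>' by (rule sample_space)
  have Ym: "Y t \<in> borel_measurable \<Omega>" if "t \<ge> 1" for t
  proof -
    have "(*v) (transpose U) \<in> borel_measurable borel"
      by (intro borel_measurable_continuous_onI linear_continuous_on
          bounded_bilinear.bounded_linear_right[OF bounded_bilinear_matrix_vector_mult])
    from measurable_compose[OF H.output_measurable[OF that] this] show ?thesis
      by (simp add: Y[abs_def])
  qed
  \<comment> \<open>The possible values of each \<open>Y t\<close>: the projections of the finitely
    many encoded symbols.\<close>
  define V where "V = range (\<lambda>k. transpose U *v axis k (1 :: real))"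
  have "finite V" by (simp add: V_def)
  have YV: "Y t \<omega> \<in> V" if "t \<ge> 1" "\<omega> \<in> space \<Omega>" for t \<omega>
    using H.output_discrete[OF that] by (auto simp: V_def Y)
  define triple where "triple = (\<lambda>\<omega>. (Y 1 \<omega>, Y 2 \<omega>, Y 3 \<omega>))"
  have triple_meas: "triple \<in> borel_measurable \<Omega>"
    unfolding triple_def by (intro borel_measurable_Pair Ym) auto
  define Z where "Z = (\<lambda>\<omega>. moment_observation (triple \<omega>))"
  have integrable: "integrable \<Omega> (\<lambda>\<omega>. g (Z \<omega>))"
    if "g \<in> borel_measurable borel"
    for g :: "(real ^ 'd) \<times> (real ^ 'd ^ 'd) \<times> (real ^ 'd ^ 'd ^ 'd) \<Rightarrow> 'c::{banach, second_countable_topology}"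
    unfolding Z_def
  proof (rule H.integrable_finite_values[OF triple_meas measurable_compose[OF borel_measurable_moment_observation that]])
    show "finite (V \<times> V \<times> V)" using \<open>finite V\<close> by simp
    show "triple \<omega> \<in> V \<times> V \<times> V" if "\<omega> \<in> space \<Omega>" for \<omega>
      using YV that by (simp add: triple_def)
  qed
  have Z_eq: "Z \<omega> = (Y 1 \<omega>, outer2 (Y 2 \<omega>) (Y 1 \<omega>), outer3 (Y 3 \<omega>) (Y 1 \<omega>) (Y 2 \<omega>))" for \<omega>
    by (simp add: Z_def triple_def moment_observation_def)
  have Z_int: "integrable \<Omega> Z" using integrable[of "\<lambda>z. z"] by simp
  define \<theta> where "\<theta> = (\<mu>, \<Sigma>, K)"
  have Z_mean: "integral\<^sup>L \<Omega> Z = \<theta>"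
  proof -
    have 1: "fst (integral\<^sup>L \<Omega> Z) = \<mu>"
      using integral_bounded_linear[OF bounded_linear_fst Z_int] by (simp add: \<mu> Z_eq)
    have snd: "snd (integral\<^sup>L \<Omega> Z) = (LINT \<omega>|\<Omega>. snd (Z \<omega>))"
      using integral_bounded_linear[OF bounded_linear_snd Z_int] by simp
    have snd_int: "integrable \<Omega> (\<lambda>\<omega>. snd (Z \<omega>))"
      by (rule integrable_bounded_linear[OF bounded_linear_snd Z_int])
    have 2: "fst (snd (integral\<^sup>L \<Omega> Z)) = \<Sigma>"
      using integral_bounded_linear[OF bounded_linear_fst snd_int] by (simp add: snd \<Sigma> Z_eq)
    have 3: "snd (snd (integral\<^sup>L \<Omega> Z)) = K"
      using integral_bounded_linear[OF bounded_linear_snd snd_int] by (simp add: snd K Z_eq)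
    show ?thesis unfolding \<theta>_def by (intro prod_eqI) (simp_all add: 1 2 3)
  qed

  \<comment> \<open>The sample is numbered from 1 and the sums in \<open>delta_method\<close> start
    at 0, hence the shift by \<open>Suc\<close>.\<close>
  define Zs where "Zs = (\<lambda>i \<omega>. moment_observation (Ys (Suc i) \<omega>))"
  have Ys_meas: "Ys (Suc i) \<in> borel_measurable \<Omega>'" for i
    using independent by (auto simp: S.indep_vars_def)
  have Ys_distr: "distr \<Omega>' borel (Ys (Suc i)) = distr \<Omega> borel triple" for i
    by (simp add: identically_distributed triple_def)
  have Zs_indep: "S.indep_vars (\<lambda>_. borel) Zs UNIV"
    unfolding Zs_def
  proof (rule S.indep_vars_compose2[OF _ borel_measurable_moment_observation])
    have "S.indep_vars (\<lambda>_. borel) Ys (range Suc)"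
      by (rule S.indep_vars_subset[OF independent]) auto
    then show "S.indep_vars (\<lambda>_. borel) (\<lambda>i. Ys (Suc i)) UNIV"
      by (rule S.indep_vars_reindex) simp
  qed
  have Zs_distr: "distr \<Omega>' borel (Zs i) = distr (distr \<Omega> borel triple) borel moment_observation" for i
    unfolding Ys_distr[of i, symmetric] Zs_def
    by (subst distr_distr[OF borel_measurable_moment_observation]) (simp_all add: Ys_meas comp_def)
  have transfer: "integrable \<Omega>' (\<lambda>\<omega>. g (Zs 0 \<omega>)) \<longleftrightarrow> integrable \<Omega> (\<lambda>\<omega>. g (Z \<omega>))"
      "(LINT \<omega>|\<Omega>'. g (Zs 0 \<omega>)) = (LINT \<omega>|\<Omega>. g (Z \<omega>))"
    if "g \<in> borel_measurable borel"
    for g :: "(real ^ 'd) \<times> (real ^ 'd ^ 'd) \<times> (real ^ 'd ^ 'd ^ 'd) \<Rightarrow> 'c::{banach, second_countable_topology}"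
    unfolding Zs_def Z_def
    using integrable_eq_if_distr_eq[OF Ys_distr Ys_meas triple_meas
        measurable_compose[OF borel_measurable_moment_observation that]]
      integral_eq_if_distr_eq[OF Ys_distr Ys_meas triple_meas
        measurable_compose[OF borel_measurable_moment_observation that]] by auto

  \<comment> \<open>The estimate is \<open>F\<close> at the sample mean, including the default value
    \<open>c\<close> for a singular matrix. Invertibility is an open condition, so near \<theta> the
    default is never taken and the derivative is that of the likelihood.\<close>
  define F where "F = (\<lambda>(m, S, K). if invertible S then spectral_likelihood m S K y T else c)"
  have F_meas: "F \<in> borel_measurable borel"
    unfolding F_def by (rule borel_measurable_spectral_likelihood)
  have F_\<theta>: "F \<theta> = Pr" using invertible by (simp add: F_def \<theta>_def Pr)
  define F' where "F' = (\<lambda>p. \<beta> \<bullet> stack_moments p)"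
  have F_deriv: "(F has_derivative F') (at \<theta>)"
  proof (rule has_derivative_transform_within_open)
    show "((\<lambda>(m, S, K). spectral_likelihood m S K y T) has_derivative F') (at \<theta>)"
      unfolding \<theta>_def F'_def \<beta> by (rule has_derivative_spectral_likelihood[OF invertible])
    show "open {p :: (real ^ 'd) \<times> (real ^ 'd ^ 'd) \<times> (real ^ 'd ^ 'd ^ 'd). invertible (fst (snd p))}"
      using open_vimage[OF open_invertible, of "\<lambda>p. fst (snd p)"] by (simp add: vimage_def continuous_intros)
  qed (use invertible in \<open>auto simp: \<theta>_def F_def\<close>)

  have "weak_conv_m
    (\<lambda>n. distr \<Omega>' borel (\<lambda>\<omega>. sqrt (real n) * (F ((1 / real n) *\<^sub>R (\<Sum>i<n. Zs i \<omega>)) - F \<theta>)))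
    (normal_law 0 (LINT \<omega>|\<Omega>'. (F' (Zs 0 \<omega> - \<theta>))\<^sup>2))"
  proof (rule S.delta_method[OF Zs_indep Zs_distr _ _ F_meas F_deriv])
    show "integrable \<Omega>' (\<lambda>\<omega>. (norm (Zs 0 \<omega>))\<^sup>2)"
      using transfer(1)[of "\<lambda>z. (norm z)\<^sup>2"] integrable[of "\<lambda>z. (norm z)\<^sup>2"] by simp
    show "\<theta> = integral\<^sup>L \<Omega>' (Zs 0)"
      using transfer(2)[of "\<lambda>z. z"] Z_mean by simp
  qed
  moreover have "F ((1 / real n) *\<^sub>R (\<Sum>i<n. Zs i \<omega>)) = Prh n \<omega>" for n \<omega>
  proof -
    have "(1 / real n) *\<^sub>R (\<Sum>i<n. Zs i \<omega>) = (\<mu>h n \<omega>, \<Sigma>h n \<omega>, Kh n \<omega>)"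
      by (simp add: \<mu>h \<Sigma>h Kh prod_eq_iff fst_sum snd_sum sum.atLeast1_atMost_eq Zs_def
          moment_observation_def split_def)
    then show ?thesis by (simp add: F_def Prh)
  qed
  \<comment> \<open>The variance from \<open>delta_method\<close> is moved back to the Markov model;
    as stacking is linear, it is the variance of \<beta> . W for the stacked observation
    \<open>W\<close>.\<close>
  moreover have "(LINT \<omega>|\<Omega>'. (F' (Zs 0 \<omega> - \<theta>))\<^sup>2) = \<beta> \<bullet> (covariance_matrix \<Omega>
      (\<lambda>\<omega>. stack3 (Y 1 \<omega>) (flatten2 (outer2 (Y 2 \<omega>) (Y 1 \<omega>)))
        (flatten3 (outer3 (Y 3 \<omega>) (Y 1 \<omega>) (Y 2 \<omega>)))) *v \<beta>)"
  proof -
    have st: "bounded_linear (stack_moments :: _ \<Rightarrow> real ^ ('d + ('d \<times> 'd) + ('d \<times> 'd \<times> 'd)))"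
      using linear_stack_moments by (simp add: linear_conv_bounded_linear)
    have [measurable]: "(stack_moments :: _ \<Rightarrow> real ^ ('d + ('d \<times> 'd) + ('d \<times> 'd \<times> 'd))) \<in> borel_measurable borel"
      by (intro borel_measurable_continuous_onI linear_continuous_on st)
    define W where "W = (\<lambda>\<omega>. stack_moments (Z \<omega>))"
    have W_eq: "W = (\<lambda>\<omega>. stack3 (Y 1 \<omega>) (flatten2 (outer2 (Y 2 \<omega>) (Y 1 \<omega>)))
        (flatten3 (outer3 (Y 3 \<omega>) (Y 1 \<omega>) (Y 2 \<omega>))))"
      by (simp add: W_def Z_eq stack_moments_def)
    have W_int: "integrable \<Omega> W"
      unfolding W_def by (rule integrable_bounded_linear[OF st Z_int])
    have W_mean: "integral\<^sup>L \<Omega> W = stack_moments \<theta>"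
      unfolding W_def Z_mean[symmetric] by (rule integral_bounded_linear[OF st Z_int])
    have "(LINT \<omega>|\<Omega>'. (F' (Zs 0 \<omega> - \<theta>))\<^sup>2) = (LINT \<omega>|\<Omega>. (F' (Z \<omega> - \<theta>))\<^sup>2)"
      by (rule transfer(2)) (simp add: F'_def)
    also have "\<dots> = (LINT \<omega>|\<Omega>. (\<beta> \<bullet> (W \<omega> - stack_moments \<theta>))\<^sup>2)"
      by (simp add: F'_def W_def linear_diff[OF linear_stack_moments])
    also have "\<dots> = \<beta> \<bullet> (covariance_matrix \<Omega> W *v \<beta>)"
    proof -
      have "integrable \<Omega> (\<lambda>\<omega>. (W \<omega> - stack_moments \<theta>) $ i * (W \<omega> - stack_moments \<theta>) $ j)" for i j
        unfolding W_def
        by (rule integrable[of "\<lambda>z. (stack_moments z - stack_moments \<theta>) $ i * (stack_moments z - stack_moments \<theta>) $ j"])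
          (intro borel_measurable_continuous_onI continuous_on_mult continuous_on_component
            continuous_on_diff continuous_on_const linear_continuous_on st)
      then show ?thesis
        using covariance_matrix_quadratic_form[OF W_int, of \<beta>] by (simp add: W_mean)
    qed
    finally show ?thesis by (simp add: W_eq)
  qed
  ultimately show ?thesis by (simp add: F_\<theta>)
qed

end
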